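(* Let $L^*\in\mathcal S_{[N]}^{++}$ and let $\Phi=\Phi_{L^*}$ be the expected log-likelihood. The null space $\{H\in\mathcal S_{[N]}:\mathrm d^2\Phi(L^* )(H,H)=0\}$ of the quadratic Hessian map $H\in\mathcal S_{[N]}\mapsto\mathrm d^2\Phi(L^* )(H,H)$ is given by $$\mathcal N(L^* )=\big\{H\in\mathcal S_{[N]}: H_{i,j}=0\ \text{for all } i,j\in[N]\ \text{such that } i\sim_{L^*}j\big\}.$$ In particular, $\mathrm d^2\Phi(L^* )$ is negative definite if and only if $L^*$ is irreducible.
   Context: Fix a positive integer $N$ and let $[N]=\{1,\dots,N\}$. $\mathcal S_{[N]}$ is the space of real symmetric $N\times N$ matrices and $\mathcal S_{[N]}^{++}$ is the (open) subset of positive definite ones. For an $N\times N$ matrix $A$ and $J\subseteq[N]$, $A_J$ is the restriction of $A$ to $J\times J$; convention: $\det A_\emptyset=1$. For $L\in\mathcal S_{[N]}^{++}$, $\mathsf{DPP}(L)$ is the probability distribution on subsets of $[N]$ given by $p_J(L)=\det(L_J)/\det(I+L)$, $J\subseteq[N]$. For fixed $L^*\in\mathcal S_{[N]}^{++}$, the expected log-likelihood is $$\Phi_{L^*}(L)=\sum_{J\subseteq[N]}p_J(L^* )\log\det(L_J)-\log\det(I+L),\qquad L\in\mathcal S_{[N]}^{++}.$$ $\mathrm d^2\Phi(L)$ denotes the second derivative (Hessian) of $\Phi$ at $L$, a bilinear form on $\mathcal S_{[N]}$. The determinantal graph $\mathcal G_L$ is the undirected graph with vertex set $[N]$ and edge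 set $\{\{i,j\}:L_{i,j}\neq0\}$. Write $i\sim_L j$ if there is a path in $\mathcal G_L$ connecting $i$ and $j$ (in particular $i\sim_L i$). A matrix $L\in\mathcal S_{[N]}^{++}$ is irreducible if it has only one block, i.e. there is no partition of $[N]$ into at least two nonempty sets such that $L_{i,j}=0$ whenever $i,j$ lie in different sets; equivalently, $\mathcal G_L$ is connected. *)

theory Defs
  imports "HOL-Analysis.Analysis" "HOL-Library.Disjoint_Sets"
begin

(* The ground set [N] is rendered as a finite index type 'n, so that N = CARD('n) >= 1. *)

definition sym_mats :: "(real^'n^'n) set" where
  "sym_mats = {A. transpose A = A}"

definition spd_mats :: "(real^'n^'n) set" where
  "spd_mats = {A \<in> sym_mats. \<forall>x. x \<noteq> 0 \<longrightarrow> x \<bullet> (A *v x) > 0}"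

(* det (A_J): the Leibniz formula of the library determinant, with the index type replaced by
   the subset J. *)
definition minor_det :: "real^'n^'n \<Rightarrow> 'n set \<Rightarrow> real" where
  "minor_det A J = (\<Sum>p | p permutes J. of_int (sign p) * (\<Prod>i\<in>J. A $ i $ p i))"

lemma minor_det_UNIV: "minor_det A UNIV = det A"
  by (simp add: minor_det_def det_def)

lemma minor_det_empty: "minor_det A {} = 1"
  by (simp add: minor_det_def sign_id[unfolded id_def] flip: id_def)

definition dpp_prob :: "real^'n^'n \<Rightarrow> 'n set \<Rightarrow> real" where
  "dpp_prob L J = minor_det L J / det (mat 1 + L)"

definition expected_loglik :: "real^'n^'n \<Rightarrow> real^'n^'n \<Rightarrow> real" where
  "expected_loglik Ls L =
     (\<Sum>J\<in>UNIV. dpp_prob Ls J * ln (minor_det L J)) - ln (det (mat 1 + L))"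

(* Second Frechet derivative of F on the domain S: the derivative at L, in the direction H, of
   the map sending M to dF(M)(K).  All derivatives are taken within S, the domain of F.
   For S = spd_mats, which spans only the proper subspace sym_mats, frechet_derivative
   is a choice among several linear maps, but they all agree on sym_mats (see
   has_derivative_spd_mats_unique below); the form is meant for symmetric H and K only. *)
definition second_derivative_on ::
    "'a set \<Rightarrow> ('a::real_normed_vector \<Rightarrow> real) \<Rightarrow> 'a \<Rightarrow> 'a \<Rightarrow> 'a \<Rightarrow> real" where
  "second_derivative_on S F L H K =
     frechet_derivative (\<lambda>M. frechet_derivative F (at M within S) K) (at L within S) H"

abbreviation hessian_loglik :: "real^'n^'n \<Rightarrow> real^'n^'n \<Rightarrow> real^'n^'n \<Rightarrow> real^'n^'n \<Rightarrow> real" where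
  "hessian_loglik Ls \<equiv> second_derivative_on spd_mats (expected_loglik Ls)"

definition negative_definite_on :: "'a::zero set \<Rightarrow> ('a \<Rightarrow> 'a \<Rightarrow> real) \<Rightarrow> bool" where
  "negative_definite_on V B \<longleftrightarrow> (\<forall>H\<in>V. H \<noteq> 0 \<longrightarrow> B H H < 0)"

definition det_graph_edges :: "real^'n^'n \<Rightarrow> 'n set set" where
  "det_graph_edges L = {{i, j} | i j. L $ i $ j \<noteq> 0}"

definition graph_connected :: "real^'n^'n \<Rightarrow> 'n \<Rightarrow> 'n \<Rightarrow> bool" where
  "graph_connected L i j \<longleftrightarrow> (i, j) \<in> {(a, b). {a, b} \<in> det_graph_edges L}\<^sup>*"

definition irreducible_mat :: "real^'n^'n \<Rightarrow> bool" where
  "irreducible_mat L \<longleftrightarrow>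
     \<not> (\<exists>P. partition_on UNIV P \<and> card P \<ge> 2 \<and>
          (\<forall>A\<in>P. \<forall>B\<in>P. A \<noteq> B \<longrightarrow> (\<forall>i\<in>A. \<forall>j\<in>B. L $ i $ j = 0)))"

lemma spd_mats_lower_bound:
  fixes L :: "real^'n^'n"
  assumes "L \<in> spd_mats"
  obtains c where "c > 0" "\<And>x. x \<bullet> (L *v x) \<ge> c * (norm x)\<^sup>2"
proof -
  have "continuous_on (sphere 0 1) (\<lambda>x. x \<bullet> (L *v x))"
    by (intro continuous_intros)
  then have "\<exists>y\<in>sphere 0 1. \<forall>x\<in>sphere 0 1. y \<bullet> (L *v y) \<le> x \<bullet> (L *v x)"
    by (intro continuous_attains_inf compact_sphere) simp_all
  then obtain y where y: "y \<in> sphere 0 1"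
    and le: "\<And>x. x \<in> sphere 0 1 \<Longrightarrow> y \<bullet> (L *v y) \<le> x \<bullet> (L *v x)"
    by blast
  have "y \<noteq> 0" using y by auto
  hence pos: "y \<bullet> (L *v y) > 0"
    using assms by (simp add: spd_mats_def)
  have "x \<bullet> (L *v x) \<ge> (y \<bullet> (L *v y)) * (norm x)\<^sup>2" for x
  proof (cases "x = 0")
    case False
    define u where "u = (1 / norm x) *\<^sub>R x"
    have "y \<bullet> (L *v y) \<le> u \<bullet> (L *v u)"
      using False by (intro le) (simp add: u_def)
    also have "u \<bullet> (L *v u) = (x \<bullet> (L *v x)) / (norm x)\<^sup>2"
      by (simp add: u_def matrix_vector_mult_scaleR power2_eq_square)
    finally show ?thesis
      using False by (simp add: field_simps)
  qed simp
  with pos show ?thesis using that by blast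
qed

lemma spd_mats_open_in_sym_mats:
  fixes L K :: "real^'n^'n"
  assumes L: "L \<in> spd_mats" and K: "K \<in> sym_mats"
  shows "\<forall>\<^sub>F t in at (0::real). L + t *\<^sub>R K \<in> spd_mats"
proof -
  obtain c where c: "c > 0" "\<And>x. x \<bullet> (L *v x) \<ge> c * (norm x)\<^sup>2"
    using spd_mats_lower_bound[OF L] by blast
  obtain B where B: "B > 0" "\<And>x. norm (K *v x) \<le> norm x * B"
    using bounded_linear.pos_bounded[OF matrix_vector_mul_bounded_linear[of K]] by blast
  have *: "L + t *\<^sub>R K \<in> spd_mats" if t: "\<bar>t\<bar> < c / B" for t
  proof -
    have "transpose (L + t *\<^sub>R K) = L + t *\<^sub>R K"
      using L K by (simp add: spd_mats_def sym_mats_def transpose_def vec_eq_iff)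
    moreover have "x \<bullet> ((L + t *\<^sub>R K) *v x) > 0" if x: "x \<noteq> 0" for x
    proof -
      have "\<bar>x \<bullet> (K *v x)\<bar> \<le> norm x * (norm x * B)"
        using Cauchy_Schwarz_ineq2[of x "K *v x"] B(2)[of x]
        by (meson mult_left_mono norm_ge_zero order_trans)
      hence "\<bar>t * (x \<bullet> (K *v x))\<bar> \<le> \<bar>t\<bar> * (B * (norm x)\<^sup>2)"
        unfolding abs_mult by (intro mult_left_mono) (simp_all add: power2_eq_square mult_ac)
      also have "\<dots> < c * (norm x)\<^sup>2"
        using t B(1) x by (simp add: field_simps)
      finally have "\<bar>t * (x \<bullet> (K *v x))\<bar> < x \<bullet> (L *v x)"
        using c(2)[of x] by linarith
      moreover have "x \<bullet> ((L + t *\<^sub>R K) *v x) = x \<bullet> (L *v x) + t * (x \<bullet> (K *v x))"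
        by (simp add: matrix_vector_mult_add_rdistrib scaleR_matrix_vector_assoc[symmetric]
            inner_add_right)
      ultimately show ?thesis by linarith
    qed
    ultimately show ?thesis by (simp add: spd_mats_def sym_mats_def)
  qed
  have "c / B > 0" using c B by simp
  thus ?thesis
    unfolding eventually_at by (intro exI[of _ "c / B"]) (auto intro: * simp: dist_real_def)
qed

lemma has_derivative_spd_mats_unique:
  fixes F :: "real^'n^'n \<Rightarrow> real"
  assumes D: "(F has_derivative D) (at L within spd_mats)"
    and D': "(F has_derivative D') (at L within spd_mats)"
    and L: "L \<in> spd_mats" and K: "K \<in> sym_mats"
  shows "D K = D' K"
proof -
  define T where "T = {t::real. L + t *\<^sub>R K \<in> spd_mats}"
  have line: "((\<lambda>t. L + t *\<^sub>R K) has_derivative (\<lambda>t. t *\<^sub>R K)) (at 0 within T)"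
    by (auto intro!: derivative_eq_intros)
  have sub: "(\<lambda>t. L + t *\<^sub>R K) ` T \<subseteq> spd_mats"
    by (auto simp: T_def)
  have at: "at 0 within T = at (0::real)"
  proof -
    have "\<forall>\<^sub>F t in at 0. t \<in> T"
      using spd_mats_open_in_sym_mats[OF L K] by (simp add: T_def)
    then obtain d where d: "d > 0" "\<And>t. t \<noteq> 0 \<Longrightarrow> dist t 0 < d \<Longrightarrow> t \<in> T"
      by (auto simp: eventually_at)
    have "0 \<in> T"
      using L by (simp add: T_def)
    have "ball 0 d \<subseteq> T"
    proof
      fix t :: real assume "t \<in> ball 0 d"
      thus "t \<in> T"
        using d(2)[of t] \<open>0 \<in> T\<close> by (cases "t = 0") (simp_all add: dist_commute)
    qed
    hence "0 \<in> interior T"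
      using d(1) by (intro interiorI[of "ball 0 d"]) simp_all
    thus ?thesis
      by (rule at_within_interior)
  qed
  have *: "((\<lambda>t. F (L + t *\<^sub>R K)) has_derivative (\<lambda>t. E (t *\<^sub>R K))) (at 0)"
    if "(F has_derivative E) (at L within spd_mats)" for E
    using has_derivative_in_compose[OF line, of F E] has_derivative_subset[OF that sub] at
    by simp
  have "(\<lambda>t. D (t *\<^sub>R K)) = (\<lambda>t. D' (t *\<^sub>R K))"
    by (rule has_derivative_unique[OF *[OF D] *[OF D']])
  from fun_cong[OF this, of 1] show ?thesis by simp
qed

end

(* Write f_J(L) for det(L_J).  Since det(I + L) is the sum of all f_J(L), and the weights of the
   expected log-likelihood at Ls are f_J(Ls) / det(I + Ls), the terms with second derivatives of
   the f_J cancel at L = Ls, and the Hessian at (H, H) is minus the variance, under DPP(Ls), of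
   J |-> df_J(Ls)(H) / f_J(Ls).  This function vanishes at the empty set, so H is in the null
   space iff df_J(Ls)(H) = 0 for every J.  If H vanishes on all connected pairs, each term in the
   Leibniz expansion of df_J(Ls)(H) is 0, because the cycle of the permutation through the
   differentiated entry closes up a path in the graph.  Conversely, if H i j is nonzero for a
   connected pair at minimal distance, let J be the vertex set of a shortest path from i to j:
   it has no chords, so only the cyclic permutation along the path and its inverse
   contribute to df_J(Ls)(H), by two equal nonzero terms. *)

theory Submission
  imports Defs
begin

section \<open>Derivatives of the principal minors\<close>

text \<open>The Leibniz sum of \<open>minor_det\<close>, differentiated by the product rule. It
  stays an explicit sum over permutations because both inclusions for the null space examine its
  single terms.\<close>

definition minor_det_deriv :: "real^'n^'n \<Rightarrow> 'n set \<Rightarrow> real^'n^'n \<Rightarrow> real" where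
  "minor_det_deriv L J H = (\<Sum>p | p permutes J. of_int (sign p) *
     (\<Sum>i\<in>J. H $ i $ p i * (\<Prod>j\<in>J - {i}. L $ j $ p j)))"

lemma has_derivative_matrix_entry:
  fixes F :: "(real^'n^'m) filter"
  shows "((\<lambda>M. M $ i $ j) has_derivative (\<lambda>H. H $ i $ j)) F"
  by (intro bounded_linear_imp_has_derivative bounded_linear_compose[OF bounded_linear_vec_nth]
      bounded_linear_vec_nth)

lemma has_derivative_minor_det:
  fixes L :: "real^'n^'n"
  shows "((\<lambda>M. minor_det M J) has_derivative minor_det_deriv L J) (at L within S)"
proof -
  have "((\<lambda>M. minor_det M J) has_derivative (\<lambda>H. minor_det_deriv L J H)) (at L within S)"
    unfolding minor_det_def minor_det_deriv_def
    by (intro has_derivative_sum has_derivative_mult_right has_derivative_prod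
        has_derivative_matrix_entry)
  thus ?thesis by simp
qed

text \<open>Bare existence suffices, because the second derivatives of the minors cancel in the
  Hessian at \<open>Ls\<close>.\<close>

lemma minor_det_deriv_has_derivative:
  fixes L :: "real^'n^'n"
  obtains D where "((\<lambda>M. minor_det_deriv M J K) has_derivative D) (at L within S)"
proof -
  have "\<exists>D. ((\<lambda>M. minor_det_deriv M J K) has_derivative D) (at L within S)"
    unfolding minor_det_deriv_def
    by (rule exI has_derivative_sum has_derivative_mult_right has_derivative_prod
        has_derivative_matrix_entry)+
  thus ?thesis using that by blast
qed

section \<open>Sum and positivity of the principal minors\<close>

text \<open>When the product in a Leibniz term is expanded, \<open>J\<close> collects the rows whose
  factor comes from \<open>L\<close>. The identity factors on the other rows multiply to 1 if the
  permutation fixes the complement of \<open>J\<close> pointwise, and to 0 otherwise.\<close>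

lemma sum_minor_det:
  fixes L :: "real^'n^'n"
  shows "(\<Sum>J\<in>UNIV. minor_det L J) = det (mat 1 + L)"
proof -
  let ?d = "\<lambda>p i. (mat 1 :: real^'n^'n) $ i $ p i"
  have one: "(\<Prod>i\<in>UNIV - J. ?d p i) = (if p permutes J then 1 else 0)"
    if p: "p permutes UNIV" for p and J :: "'n set"
  proof (cases "p permutes J")
    case True
    then show ?thesis by (auto simp: mat_def permutes_def intro!: prod.neutral)
  next
    case False
    with p obtain i where "i \<notin> J" "p i \<noteq> i" by (auto simp: permutes_def)
    then have "\<exists>i\<in>UNIV - J. ?d p i = 0" by (intro bexI[of _ i]) (auto simp: mat_def)
    then have "(\<Prod>i\<in>UNIV - J. ?d p i) = 0" by (intro prod_zero) auto
    then show ?thesis using False by simp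
  qed
  have "det (mat 1 + L) = (\<Sum>p | p permutes UNIV. of_int (sign p) *
          (\<Prod>i\<in>UNIV. L $ i $ p i + ?d p i))"
    by (simp add: det_def add.commute)
  also have "\<dots> = (\<Sum>p | p permutes UNIV. \<Sum>J\<in>UNIV.
          of_int (sign p) * ((\<Prod>i\<in>J. L $ i $ p i) * (\<Prod>i\<in>UNIV - J. ?d p i)))"
    by (simp add: prod_add sum_distrib_left)
  also have "\<dots> = (\<Sum>J\<in>UNIV. \<Sum>p | p permutes UNIV.
          of_int (sign p) * ((\<Prod>i\<in>J. L $ i $ p i) * (\<Prod>i\<in>UNIV - J. ?d p i)))"
    by (rule sum.swap)
  also have "\<dots> = (\<Sum>J\<in>UNIV. minor_det L J)"
  proof (rule sum.cong[OF refl])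
    fix J :: "'n set"
    have "(\<Sum>p | p permutes UNIV.
            of_int (sign p) * ((\<Prod>i\<in>J. L $ i $ p i) * (\<Prod>i\<in>UNIV - J. ?d p i)))
        = (\<Sum>p | p permutes J.
            of_int (sign p) * ((\<Prod>i\<in>J. L $ i $ p i) * (\<Prod>i\<in>UNIV - J. ?d p i)))"
      by (rule sum.mono_neutral_right) (auto simp: one finite_permutations permutes_subset)
    also have "\<dots> = minor_det L J"
      unfolding minor_det_def by (rule sum.cong) (auto simp: one permutes_subset)
    finally show "(\<Sum>p | p permutes UNIV.
            of_int (sign p) * ((\<Prod>i\<in>J. L $ i $ p i) * (\<Prod>i\<in>UNIV - J. ?d p i)))
          = minor_det L J" .
  qed
  finally show ?thesis by simp
qed

text \<open>Every matrix on the segment from the identity to \<open>A\<close> has a positive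
  quadratic form, hence a trivial kernel. The determinant starts at 1, so by the intermediate value
  theorem it could only become nonpositive by vanishing somewhere on the segment.\<close>

lemma det_pos_of_pos_def:
  fixes A :: "real^'n^'n"
  assumes pos: "\<And>x. x \<noteq> 0 \<Longrightarrow> x \<bullet> (A *v x) > 0"
  shows "det A > 0"
proof (rule ccontr)
  assume neg: "\<not> det A > 0"
  define B where "B t = (1 - t) *\<^sub>R mat 1 + t *\<^sub>R A" for t :: real
  have cont: "continuous_on {0..1} (\<lambda>t. det (B t))"
    unfolding det_def B_def by (intro continuous_intros)
  have "det (B 1) \<le> 0" "0 \<le> det (B 0)"
    using neg by (simp_all add: B_def)
  with cont obtain t where t: "0 \<le> t" "t \<le> 1" "det (B t) = 0"
    using IVT2'[of "\<lambda>t. det (B t)" 1 0 0] by auto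
  have "x = 0" if x: "B t *v x = 0" for x
  proof (rule ccontr)
    assume nz: "x \<noteq> 0"
    have "0 = x \<bullet> (B t *v x)" using x by simp
    also have "\<dots> = (1 - t) * (x \<bullet> x) + t * (x \<bullet> (A *v x))"
      by (simp add: B_def matrix_vector_mult_add_rdistrib scaleR_matrix_vector_assoc[symmetric]
            inner_add_right)
    also have "\<dots> > 0"
    proof (cases "t = 0")
      case False
      then have "t * (x \<bullet> (A *v x)) > 0" using t pos[OF nz] by simp
      moreover have "(1 - t) * (x \<bullet> x) \<ge> 0" using t by simp
      ultimately show ?thesis by linarith
    qed (use nz in simp)
    finally show False by simp
  qed
  then have "invertible (B t)"
    using invertible_left_inverse matrix_left_invertible_ker by blast
  with t(3) show False by (simp add: invertible_det_nz)
qed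

text \<open>This keeps the logarithms and quotients below well behaved. A permutation that moves a
  point outside \<open>J\<close> meets a zero entry of the padded matrix, so the determinant of that
  matrix is the Leibniz sum over \<open>J\<close>.\<close>

lemma minor_det_pos:
  fixes L :: "real^'n^'n"
  assumes L: "L \<in> spd_mats"
  shows "minor_det L J > 0"
proof -
  \<comment> \<open>The restriction to \<open>J \<times> J\<close>, padded by the identity on the complement of \<open>J\<close>.\<close>
  define M :: "real^'n^'n" where
    "M = (\<chi> i j. if i \<in> J \<and> j \<in> J then L $ i $ j else if i = j then 1 else 0)"
  have M: "x \<bullet> (M *v x) > 0" if x: "x \<noteq> 0" for x
  proof -
    \<comment> \<open>Splitting \<open>x\<close> into its parts on and off \<open>J\<close> turns
      the quadratic form of \<open>M\<close> into that of \<open>L\<close> at \<open>y\<close> plus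
      the squared norm of \<open>z\<close>.\<close>
    define y :: "real^'n" where "y = (\<chi> i. if i \<in> J then x $ i else 0)"
    define z :: "real^'n" where "z = (\<chi> i. if i \<in> J then 0 else x $ i)"
    have "M *v x = (\<chi> i. if i \<in> J then (L *v y) $ i else x $ i)"
      by (auto simp: vec_eq_iff M_def y_def matrix_vector_mult_def if_distrib[of "\<lambda>a. a * _"]
          sum.delta cong: if_cong intro!: sum.cong)
    then have "x \<bullet> (M *v x) = y \<bullet> (L *v y) + z \<bullet> z"
      by (auto simp: inner_vec_def y_def z_def sum.distrib[symmetric] intro!: sum.cong)
    moreover have "y \<noteq> 0 \<or> z \<noteq> 0"
      using x by (auto simp: vec_eq_iff y_def z_def)
    moreover have "y \<bullet> (L *v y) \<ge> 0" "y \<noteq> 0 \<Longrightarrow> y \<bullet> (L *v y) > 0"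
      using L by (cases "y = 0"; simp add: spd_mats_def less_imp_le)+
    moreover have "z \<bullet> z \<ge> 0" "z \<noteq> 0 \<Longrightarrow> z \<bullet> z > 0"
      by simp_all
    ultimately show ?thesis by linarith
  qed
  have "det M = (\<Sum>p | p permutes UNIV. of_int (sign p) * (\<Prod>i\<in>UNIV. M $ i $ p i))"
    by (simp add: det_def)
  also have "\<dots> = (\<Sum>p | p permutes J. of_int (sign p) * (\<Prod>i\<in>UNIV. M $ i $ p i))"
  proof (rule sum.mono_neutral_right)
    show "\<forall>p\<in>{p. p permutes UNIV} - {p. p permutes J}.
            of_int (sign p) * (\<Prod>i\<in>UNIV. M $ i $ p i) = 0"
    proof
      fix p assume "p \<in> {p. p permutes UNIV} - {p. p permutes J}"
      then obtain i where "i \<notin> J" "p i \<noteq> i" by (auto simp: permutes_def)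
      then have "\<exists>i\<in>UNIV. M $ i $ p i = 0" by (auto simp: M_def)
      then show "of_int (sign p) * (\<Prod>i\<in>UNIV. M $ i $ p i) = 0"
        by (simp add: prod_zero)
    qed
  qed (auto simp: finite_permutations permutes_subset)
  also have "\<dots> = minor_det L J"
    unfolding minor_det_def
  proof (rule sum.cong[OF refl])
    fix p assume "p \<in> {p. p permutes J}"
    then have p: "p permutes J" by simp
    have "(\<Prod>i\<in>UNIV. M $ i $ p i) = (\<Prod>i\<in>J. M $ i $ p i)"
      using p by (intro prod.mono_neutral_right) (auto simp: M_def permutes_def)
    also have "\<dots> = (\<Prod>i\<in>J. L $ i $ p i)"
      using p by (intro prod.cong) (auto simp: M_def permutes_in_image)
    finally show "of_int (sign p) * (\<Prod>i\<in>UNIV. M $ i $ p i)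
        = of_int (sign p) * (\<Prod>i\<in>J. L $ i $ p i)" by simp
  qed
  finally have "det M = minor_det L J" .
  with det_pos_of_pos_def[OF M] show ?thesis by simp
qed

section \<open>First and second derivatives of the expected log-likelihood\<close>

text \<open>\<open>frechet_derivative\<close> only picks some derivative within
  \<open>spd_mats\<close>. Uniqueness in symmetric directions identifies its value there with that
  of any derivative computed explicitly.\<close>

lemma frechet_derivative_spd_mats:
  fixes F :: "real^'n^'n \<Rightarrow> real"
  assumes D: "(F has_derivative D) (at L within spd_mats)"
    and "L \<in> spd_mats" "K \<in> sym_mats"
  shows "frechet_derivative F (at L within spd_mats) K = D K"
proof -
  have "(F has_derivative frechet_derivative F (at L within spd_mats)) (at L within spd_mats)"
    using D frechet_derivative_works differentiable_def by blast
  then show ?thesis using has_derivative_spd_mats_unique assms by blast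
qed

lemma frechet_derivative_expected_loglik:
  fixes Ls M :: "real^'n^'n"
  assumes M: "M \<in> spd_mats" and K: "K \<in> sym_mats"
  shows "frechet_derivative (expected_loglik Ls) (at M within spd_mats) K
    = (\<Sum>J\<in>UNIV. dpp_prob Ls J * (minor_det_deriv M J K / minor_det M J))
      - (\<Sum>J\<in>UNIV. minor_det_deriv M J K) / (\<Sum>J\<in>UNIV. minor_det M J)"
proof (rule frechet_derivative_spd_mats[OF _ M K])
  have pos: "(\<Sum>J\<in>UNIV. minor_det M J) > 0"
    by (rule sum_pos) (auto simp: minor_det_pos[OF M])
  \<comment> \<open>With \<open>det (mat 1 + M)\<close> written as a sum of minors, both logarithms
    are differentiated through \<open>minor_det_deriv\<close>.\<close>
  have eq: "expected_loglik Ls = (\<lambda>M. (\<Sum>J\<in>UNIV. dpp_prob Ls J * ln (minor_det M J))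
      - ln (\<Sum>J\<in>UNIV. minor_det M J))"
    by (simp add: fun_eq_iff expected_loglik_def sum_minor_det)
  show "(expected_loglik Ls has_derivative (\<lambda>K.
      (\<Sum>J\<in>UNIV. dpp_prob Ls J * (minor_det_deriv M J K / minor_det M J))
      - (\<Sum>J\<in>UNIV. minor_det_deriv M J K) / (\<Sum>J\<in>UNIV. minor_det M J)))
      (at M within spd_mats)"
    unfolding eq
    by (rule derivative_eq_intros has_derivative_minor_det refl pos minor_det_pos M)+
       (simp add: divide_inverse mult_ac)
qed

text \<open>The right-hand side is minus the covariance of \<open>g H\<close> and \<open>g K\<close>
  under the weights \<open>dpp_prob Ls\<close>.\<close>

lemma hessian_loglik_eq:
  fixes Ls :: "real^'n^'n"
  assumes L: "Ls \<in> spd_mats" and H: "H \<in> sym_mats" and K: "K \<in> sym_mats"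
  defines "g \<equiv> \<lambda>H J. minor_det_deriv Ls J H / minor_det Ls J"
  shows "hessian_loglik Ls Ls H K
    = (\<Sum>J\<in>UNIV. dpp_prob Ls J * g H J) * (\<Sum>J\<in>UNIV. dpp_prob Ls J * g K J)
      - (\<Sum>J\<in>UNIV. dpp_prob Ls J * (g H J * g K J))"
proof -
  let ?f = "\<lambda>M J. minor_det M J" and ?d = "\<lambda>M J. minor_det_deriv M J K"
  let ?p = "dpp_prob Ls"
  define Z where "Z = (\<Sum>J\<in>UNIV. minor_det Ls J)"
  have f: "?f Ls J > 0" for J
    by (rule minor_det_pos[OF L])
  have Z: "Z > 0" unfolding Z_def by (rule sum_pos) (auto simp: f)
  have p: "?p J = ?f Ls J / Z" for J
    by (simp add: dpp_prob_def Z_def sum_minor_det)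
  have "\<exists>D. ((\<lambda>M. ?d M J) has_derivative D) (at Ls within spd_mats)" for J
    using minor_det_deriv_has_derivative by metis
  then obtain D2 where
    D2: "\<And>J. ((\<lambda>M. ?d M J) has_derivative D2 J) (at Ls within spd_mats)"
    by metis
  let ?G = "\<lambda>M. (\<Sum>J\<in>UNIV. ?p J * (?d M J / ?f M J)) - (\<Sum>J\<in>UNIV. ?d M J) / (\<Sum>J\<in>UNIV. ?f M J)"
  let ?D = "\<lambda>H. (\<Sum>J\<in>UNIV. ?p J * (D2 J H / ?f Ls J - g H J * g K J))
      - ((\<Sum>J\<in>UNIV. D2 J H) / Z
         - (\<Sum>J\<in>UNIV. minor_det_deriv Ls J H) / Z * ((\<Sum>J\<in>UNIV. ?d Ls J) / Z))"
  have fnz: "?f Ls J \<noteq> 0" for J using f[of J] by simp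
  have Znz: "(\<Sum>J\<in>UNIV. ?f Ls J) \<noteq> 0" using Z by (simp add: Z_def)
  have "(?G has_derivative (\<lambda>H. 
      (\<Sum>J\<in>UNIV. ?p J * ((D2 J H * ?f Ls J - ?d Ls J * minor_det_deriv Ls J H) / (?f Ls J * ?f Ls J)))
      - ((\<Sum>J\<in>UNIV. D2 J H) * Z - (\<Sum>J\<in>UNIV. ?d Ls J) * (\<Sum>J\<in>UNIV. minor_det_deriv Ls J H)) / (Z * Z)))
      (at Ls within spd_mats)"
    unfolding Z_def
    by (intro has_derivative_diff has_derivative_sum has_derivative_mult_right
        has_derivative_divide' D2 has_derivative_minor_det fnz Znz)
  also have "(\<lambda>H. 
      (\<Sum>J\<in>UNIV. ?p J * ((D2 J H * ?f Ls J - ?d Ls J * minor_det_deriv Ls J H) / (?f Ls J * ?f Ls J)))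
      - ((\<Sum>J\<in>UNIV. D2 J H) * Z - (\<Sum>J\<in>UNIV. ?d Ls J) * (\<Sum>J\<in>UNIV. minor_det_deriv Ls J H)) / (Z * Z))
      = ?D"
    using fnz Z by (auto simp: fun_eq_iff g_def diff_divide_distrib mult.commute)
  finally have der: "(?G has_derivative ?D) (at Ls within spd_mats)" .
  \<comment> \<open>The formula for the first derivative is available only on
    \<open>spd_mats\<close>, which is the set within which the second derivative is taken.\<close>
  have "((\<lambda>M. frechet_derivative (expected_loglik Ls) (at M within spd_mats) K)
      has_derivative ?D) (at Ls within spd_mats)"
    by (rule has_derivative_transform[OF L _ der])
       (simp add: frechet_derivative_expected_loglik K)
  then have "hessian_loglik Ls Ls H K = ?D H"
    unfolding second_derivative_on_def by (rule frechet_derivative_spd_mats[OF _ L H])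
  \<comment> \<open>The quotient \<open>?p J / ?f Ls J\<close> is \<open>1 / Z\<close> for every
    \<open>J\<close>, so the two sums of \<open>D2\<close> cancel.\<close>
  also have "\<dots> = (\<Sum>J\<in>UNIV. minor_det_deriv Ls J H) / Z * ((\<Sum>J\<in>UNIV. ?d Ls J) / Z)
      - (\<Sum>J\<in>UNIV. ?p J * (g H J * g K J))"
    using fnz by (simp add: p right_diff_distrib sum_subtractf sum_divide_distrib)
  also have "\<dots> = (\<Sum>J\<in>UNIV. ?p J * g H J) * (\<Sum>J\<in>UNIV. ?p J * g K J)
      - (\<Sum>J\<in>UNIV. ?p J * (g H J * g K J))"
    using fnz by (simp add: p g_def sum_divide_distrib)
  finally show ?thesis .
qed

text \<open>The form is minus a variance. All weights are strictly positive, so it vanishes only if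
  \<open>g\<close> is constant.\<close>

lemma hessian_loglik_nonpos:
  fixes Ls :: "real^'n^'n"
  assumes L: "Ls \<in> spd_mats" and H: "H \<in> sym_mats"
  shows "hessian_loglik Ls Ls H H \<le> 0"
    and "hessian_loglik Ls Ls H H = 0 \<longleftrightarrow> (\<forall>J. minor_det_deriv Ls J H = 0)"
proof -
  let ?p = "dpp_prob Ls"
  define g where "g J = minor_det_deriv Ls J H / minor_det Ls J" for J
  define m where "m = (\<Sum>J\<in>UNIV. ?p J * g J)"
  have f: "minor_det Ls J > 0" for J
    by (rule minor_det_pos[OF L])
  have Z: "det (mat 1 + Ls) > 0"
    unfolding sum_minor_det[symmetric] by (rule sum_pos) (auto simp: f)
  have p: "?p J > 0" for J
    by (simp add: dpp_prob_def f Z)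
  have sum_p: "(\<Sum>J\<in>UNIV. ?p J) = 1"
    using Z by (simp add: dpp_prob_def sum_divide_distrib[symmetric] sum_minor_det)
  have "(\<Sum>J\<in>UNIV. ?p J * (g J - m)\<^sup>2)
      = (\<Sum>J\<in>UNIV. ?p J * (g J * g J)) - 2 * m * (\<Sum>J\<in>UNIV. ?p J * g J) + m\<^sup>2 * (\<Sum>J\<in>UNIV. ?p J)"
    unfolding sum_distrib_left sum_subtractf[symmetric] sum.distrib[symmetric]
    by (rule sum.cong) (simp_all add: power2_eq_square algebra_simps)
  then have var: "hessian_loglik Ls Ls H H = - (\<Sum>J\<in>UNIV. ?p J * (g J - m)\<^sup>2)"
    using hessian_loglik_eq[OF L H H] sum_p
    by (simp add: g_def m_def power2_eq_square)
  have nonneg: "?p J * (g J - m)\<^sup>2 \<ge> 0" for J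
    using p[of J] by simp
  show "hessian_loglik Ls Ls H H \<le> 0"
    unfolding var by (simp add: sum_nonneg nonneg)
  \<comment> \<open>The derivative of the empty minor is a sum over no entries. This value forces a
    constant \<open>g\<close> to be zero.\<close>
  have "g {} = 0"
    by (simp add: g_def minor_det_deriv_def)
  have "hessian_loglik Ls Ls H H = 0 \<longleftrightarrow> (\<forall>J. ?p J * (g J - m)\<^sup>2 = 0)"
    unfolding var by (simp add: sum_nonneg_eq_0_iff nonneg)
  also have "\<dots> \<longleftrightarrow> (\<forall>J. g J = m)"
    using p by (simp add: less_imp_neq[symmetric])
  also have "\<dots> \<longleftrightarrow> (\<forall>J. g J = 0)"
  proof
    assume "\<forall>J. g J = m"
    then show "\<forall>J. g J = 0" using \<open>g {} = 0\<close> by metis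
  next
    assume "\<forall>J. g J = 0"
    then show "\<forall>J. g J = m" by (simp add: m_def)
  qed
  also have "\<dots> \<longleftrightarrow> (\<forall>J. minor_det_deriv Ls J H = 0)"
    using f by (simp add: g_def less_imp_neq[symmetric])
  finally show "hessian_loglik Ls Ls H H = 0 \<longleftrightarrow> (\<forall>J. minor_det_deriv Ls J H = 0)" .
qed

section \<open>Connectivity in the determinantal graph\<close>

text \<open>Symmetry lets unordered edges be read as a relation on ordered pairs, whose powers
  describe walks of a given length.\<close>

lemma graph_connected_iff:
  fixes L :: "real^'n^'n"
  assumes "L \<in> sym_mats"
  shows "graph_connected L i j \<longleftrightarrow> (i, j) \<in> {(a, b). L $ a $ b \<noteq> 0}\<^sup>*"
proof -
  have "L $ a $ b = L $ b $ a" for a b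
    using assms by (auto simp: sym_mats_def transpose_def vec_eq_iff)
  then have "{(a, b). {a, b} \<in> det_graph_edges L} = {(a, b). L $ a $ b \<noteq> 0}"
    by (auto simp: det_graph_edges_def doubleton_eq_iff)
  then show ?thesis by (simp add: graph_connected_def)
qed

lemma graph_connected_sym:
  "graph_connected L i j \<Longrightarrow> graph_connected L j i"
  unfolding graph_connected_def
  by (rule symD[OF sym_rtrancl]) (auto simp: sym_def insert_commute)

lemma graph_connected_refl: "graph_connected L i i"
  by (simp add: graph_connected_def)

lemma graph_connected_trans:
  "graph_connected L i j \<Longrightarrow> graph_connected L j k \<Longrightarrow> graph_connected L i k"
  unfolding graph_connected_def by (rule rtrancl_trans)

lemma graph_connected_edge: "L $ i $ j \<noteq> 0 \<Longrightarrow> graph_connected L i j"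
  unfolding graph_connected_def det_graph_edges_def by auto

section \<open>Matrices vanishing on connected pairs\<close>

text \<open>If the factors from \<open>L\<close> in a term are nonzero, each point of
  \<open>J\<close> other than \<open>i\<close> is joined to its image under \<open>p\<close>. The
  cycle from \<open>p i\<close> back to \<open>i\<close> then connects the two, and the factor from
  \<open>H\<close> is zero.\<close>

lemma minor_det_deriv_eq_0:
  fixes L H :: "real^'n^'n"
  assumes H: "\<And>i j. graph_connected L i j \<Longrightarrow> H $ i $ j = 0"
  shows "minor_det_deriv L J H = 0"
proof -
  have "H $ i $ p i * (\<Prod>j\<in>J - {i}. L $ j $ p j) = 0" if p: "p permutes J" and i: "i \<in> J" for p i
  proof (cases "\<forall>j\<in>J - {i}. L $ j $ p j \<noteq> 0")
    case True
    \<comment> \<open>\<open>C\<close> replaces iteration along the cycle. If it missed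
      \<open>i\<close>, then \<open>p\<close> would map it into itself, hence onto itself by
      finiteness. Then \<open>p i\<close>, a member of \<open>C\<close>, would have a preimage in
      \<open>C\<close>, which injectivity makes equal to \<open>i\<close>.\<close>
    define C where "C = {x \<in> J. graph_connected L (p i) x}"
    have "graph_connected L (p i) i"
    proof (rule ccontr)
      assume "\<not> graph_connected L (p i) i"
      then have "i \<notin> C" by (simp add: C_def)
      have "p ` C \<subseteq> C"
      proof
        fix y assume "y \<in> p ` C"
        then obtain x where x: "x \<in> C" "y = p x" by blast
        then have "L $ x $ p x \<noteq> 0" using True \<open>i \<notin> C\<close> by (auto simp: C_def)
        then show "y \<in> C"
          using x p by (auto simp: C_def permutes_in_image
              intro: graph_connected_trans graph_connected_edge)
      qed
      then have "p ` C = C"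
        using permutes_inj_on[OF p, of C] by (intro endo_inj_surj) auto
      moreover have "p i \<in> C"
        using p i by (simp add: C_def permutes_in_image graph_connected_refl)
      ultimately obtain x where "x \<in> C" "p x = p i" by (metis imageE)
      with permutes_inj[OF p] \<open>i \<notin> C\<close> show False by (metis injD)
    qed
    then have "H $ i $ p i = 0" by (rule H[OF graph_connected_sym])
    then show ?thesis by simp
  next
    case False
    then show ?thesis by (auto simp: prod_zero_iff)
  qed
  then show ?thesis by (auto simp: minor_det_deriv_def intro!: sum.neutral)
qed

section \<open>Shortest paths and their cyclic permutations\<close>

text \<open>Shift the index of each vertex down by one and let index 0 wrap around to
  \<open>d\<close>. The wrapping step is where the entry of \<open>H\<close> is placed later; for
  \<open>d = 0\<close> the permutation is the identity.\<close>

lemma path_cycle_exists: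
  fixes v :: "nat \<Rightarrow> 'a"
  assumes inj: "inj_on v {..d}"
  obtains c where "c permutes v ` {..d}" "c (v 0) = v d" "\<And>m. m < d \<Longrightarrow> c (v (Suc m)) = v m"
proof -
  let ?J = "v ` {..d}"
  define c where "c x = (if x \<in> ?J then
      (let n = inv_into {..d} v x in if n = 0 then v d else v (n - 1)) else x)" for x
  have c: "c (v n) = (if n = 0 then v d else v (n - 1))" if "n \<le> d" for n
    using that inj by (simp add: c_def)
  have "y \<in> c ` ?J" if "y \<in> ?J" for y
  proof -
    from that obtain n where n: "n \<le> d" "y = v n" by auto
    show ?thesis
    proof (cases "n = d")
      case True
      then show ?thesis using n c[of 0] by (intro image_eqI[of _ _ "v 0"]) auto
    next
      case False
      then show ?thesis using n c[of "Suc n"] by (intro image_eqI[of _ _ "v (Suc n)"]) auto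
    qed
  qed
  moreover have "c ` ?J \<subseteq> ?J" by (auto simp: c)
  ultimately have im: "c ` ?J = ?J" by blast
  then have "bij_betw c ?J ?J"
    by (simp add: bij_betw_def finite_surj_inj)
  then have "c permutes ?J"
    by (rule bij_imp_permutes) (simp add: c_def)
  then show ?thesis using that c by simp
qed

text \<open>A permutation of the vertices of a chordless path that sends the first vertex to the last
  and otherwise moves along edges (or fixes points) has to walk the whole path back.\<close>

lemma path_permutation_unique:
  fixes v :: "nat \<Rightarrow> 'a"
  assumes inj: "inj_on v {..d}" and p: "p permutes v ` {..d}" and p0: "p (v 0) = v d"
    and chordless: "\<And>a b. a \<le> d \<Longrightarrow> b \<le> d \<Longrightarrow> E (v a) (v b) \<Longrightarrow> a \<le> Suc b"
    and step: "\<And>x. x \<in> v ` {..d} \<Longrightarrow> x \<noteq> v 0 \<Longrightarrow> E x (p x)"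
    and "m < d"
  shows "p (v (Suc m)) = v m"
  using \<open>m < d\<close>
\<comment> \<open>The induction runs from the end of the path downwards. Chordlessness excludes
  images with index below \<open>m\<close>; those with index above \<open>m\<close> are already
  taken, \<open>v d\<close> by \<open>v 0\<close> and any other \<open>v b\<close> by
  \<open>v (Suc b)\<close>.\<close>
proof (induction "d - m" arbitrary: m rule: less_induct)
  case less
  have "p (v (Suc m)) \<in> v ` {..d}"
    using p less.prems by (simp add: permutes_in_image)
  then obtain b where b: "b \<le> d" "p (v (Suc m)) = v b" by auto
  have "v (Suc m) \<noteq> v 0"
    using inj_onD[OF inj, of "Suc m" 0] less.prems by auto
  then have "Suc m \<le> Suc b"
    using chordless[of "Suc m" b] step[of "v (Suc m)"] b less.prems by auto
  moreover have "\<not> m < b"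
  proof
    assume "m < b"
    show False
    proof (cases "b = d")
      case True
      then have "v (Suc m) = v 0" using p0 b permutes_inj[OF p] by (metis injD)
      with \<open>v (Suc m) \<noteq> v 0\<close> show False ..
    next
      case False
      then have "p (v (Suc b)) = v b" using less.hyps[of b] b \<open>m < b\<close> by simp
      then have "v (Suc b) = v (Suc m)" using b permutes_inj[OF p] by (metis injD)
      then show False
        using inj_onD[OF inj, of "Suc b" "Suc m"] False b less.prems \<open>m < b\<close> by auto
    qed
  qed
  ultimately show ?case using b by simp
qed

text \<open>Of the terms indexed by a permutation \<open>p\<close> and a differentiated row
  \<open>i\<close>, only the backward cycle with row \<open>v 0\<close> and its inverse with row
  \<open>v d\<close> can survive. They agree by symmetry, and their factors from \<open>L\<close>
  are edges of the path, so the factor from \<open>H\<close> must be zero.\<close>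

lemma minor_det_deriv_shortest_path:
  fixes L H :: "real^'n^'n"
  assumes L: "L \<in> sym_mats" and H: "H \<in> sym_mats"
    and inj: "inj_on v {..d}"
    and edge: "\<And>m. m < d \<Longrightarrow> L $ v m $ v (Suc m) \<noteq> 0"
    and chordless: "\<And>a b. b \<le> d \<Longrightarrow> Suc a < b \<Longrightarrow> L $ v a $ v b = 0"
    and zero: "\<And>a b. a \<le> b \<Longrightarrow> b \<le> d \<Longrightarrow> b - a < d \<Longrightarrow> H $ v a $ v b = 0"
    and deriv: "minor_det_deriv L (v ` {..d}) H = 0"
  shows "H $ v 0 $ v d = 0"
proof -
  let ?J = "v ` {..d}"
  have L_sym: "L $ a $ b = L $ b $ a" for a b
    using L by (auto simp: sym_mats_def transpose_def vec_eq_iff)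
  have H_sym: "H $ a $ b = H $ b $ a" for a b
    using H by (auto simp: sym_mats_def transpose_def vec_eq_iff)
  define t where "t p i = of_int (sign p) * (H $ i $ p i * (\<Prod>j\<in>?J - {i}. L $ j $ p j))"
    for p i
  obtain c where c: "c permutes ?J" "c (v 0) = v d" "\<And>m. m < d \<Longrightarrow> c (v (Suc m)) = v m"
    using path_cycle_exists[OF inj] by blast
  \<comment> \<open>Reindexing the product along \<open>p\<close> and using symmetry, inversion of
    the permutation moves the differentiated row from \<open>i\<close> to
    \<open>p i\<close>.\<close>
  have t_inv: "t (inv p) (p i) = t p i" if p: "p permutes ?J" for p i
  proof -
    have bij: "bij_betw p (?J - {i}) (?J - {p i})"
      using permutes_imp_bij[OF p] permutes_inj[OF p]
      by (auto simp: bij_betw_def image_set_diff permutes_image[OF p] intro: inj_on_subset)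
    have "(\<Prod>j\<in>?J - {p i}. L $ j $ inv p j) = (\<Prod>j\<in>?J - {i}. L $ p j $ inv p (p j))"
      by (rule prod.reindex_bij_betw[OF bij, symmetric])
    also have "\<dots> = (\<Prod>j\<in>?J - {i}. L $ j $ p j)"
      by (simp add: permutes_inverses[OF p] L_sym)
    finally show ?thesis
      using sign_inverse[OF permutes_imp_permutation[OF _ p]]
      by (simp add: t_def permutes_inverses[OF p] H_sym)
  qed
  have only_c: "t p (v 0) = 0" if p: "p permutes ?J" and "p \<noteq> c" for p
  proof (rule ccontr)
    assume nz: "t p (v 0) \<noteq> 0"
    have "p (v 0) \<in> ?J" using p by (simp add: permutes_in_image)
    then obtain b where b: "b \<le> d" "p (v 0) = v b" by auto
    \<comment> \<open>Only pairs a full \<open>d\<close> steps apart escape \<open>zero\<close>, so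
      a nonzero term must send \<open>v 0\<close> to \<open>v d\<close>.\<close>
    have "b = d"
      using zero[of 0 b] nz b by (cases "b = d") (auto simp: t_def)
    then have p0: "p (v 0) = v d" using b by simp
    have step: "L $ x $ p x \<noteq> 0" if "x \<in> ?J" "x \<noteq> v 0" for x
      using nz that by (auto simp: t_def)
    have "p (v (Suc m)) = v m" if "m < d" for m
    proof (rule path_permutation_unique[OF inj p p0 _ _ that, where E = "\<lambda>a b. L $ a $ b \<noteq> 0"])
      fix a b assume "a \<le> d" "b \<le> d" "L $ v a $ v b \<noteq> 0"
      then show "a \<le> Suc b" using chordless[of a b] L_sym by (metis not_less)
    qed (use step in auto)
    then have "p (v n) = c (v n)" if "n \<le> d" for n
      using that c p0 by (cases n) auto
    then have "p x = c x" for x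
      using p c(1) by (cases "x \<in> ?J") (auto simp: permutes_def)
    with \<open>p \<noteq> c\<close> show False by auto
  qed
  have T0: "(\<Sum>p | p permutes ?J. t p (v 0)) = t c (v 0)"
    using c(1) only_c finite_permutations[of ?J]
    by (subst sum.mono_neutral_right[where S = "{c}"]) auto
  have Td: "(\<Sum>p | p permutes ?J. t p (v d)) = t c (v 0)"
  proof -
    \<comment> \<open>If \<open>p\<close> does not send \<open>v 0\<close> to \<open>v d\<close>,
      \<open>t_inv\<close> does not lead to row \<open>v d\<close>, but then both terms
      vanish.\<close>
    have eq: "t (inv p) (v d) = t p (v 0)" if p: "p permutes ?J" for p
    proof (cases "p (v 0) = v d")
      case True
      then show ?thesis using t_inv[OF p, of "v 0"] by simp
    next
      case False
      have 1: "t p (v 0) = 0"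
        using only_c[OF p] c(2) False by auto
      have "inv p (v d) \<in> ?J" using permutes_inv[OF p] by (simp add: permutes_in_image)
      then obtain a where a: "a \<le> d" "inv p (v d) = v a" by auto
      then have "a \<noteq> 0" using False permutes_inverses[OF p] by metis
      then have "H $ v a $ v d = 0" using zero[of a d] a by simp
      then have "t (inv p) (v d) = 0" using a H_sym[of "v d" "v a"] by (simp add: t_def)
      with 1 show ?thesis by simp
    qed
    have "(\<Sum>p | p permutes ?J. t p (v d)) = (\<Sum>p | p permutes ?J. t (inv p) (v d))"
      by (rule sum_permutations_inverse)
    also have "\<dots> = (\<Sum>p | p permutes ?J. t p (v 0))"
      by (rule sum.cong) (auto simp: eq)
    finally show ?thesis using T0 by simp
  qed
  \<comment> \<open>An interior vertex is fewer than \<open>d\<close> steps from every vertex of the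
    path, so \<open>zero\<close> applies.\<close>
  have other: "t p i = 0" if p: "p permutes ?J" and i: "i \<in> ?J" "i \<noteq> v 0" "i \<noteq> v d" for p i
  proof -
    from i obtain a where a: "a \<le> d" "i = v a" by auto
    have "a \<noteq> 0" "a \<noteq> d" using a i by metis+
    have "p i \<in> ?J" using p i by (simp add: permutes_in_image)
    then obtain b where b: "b \<le> d" "p i = v b" by auto
    have "H $ i $ p i = 0"
      using zero[of a b] zero[of b a] H_sym[of "v a" "v b"] a b \<open>a \<noteq> 0\<close> \<open>a \<noteq> d\<close>
      by (cases "a \<le> b") auto
    then show ?thesis by (simp add: t_def)
  qed
  have "0 = (\<Sum>p | p permutes ?J. \<Sum>i\<in>?J. t p i)"
    using deriv by (simp add: minor_det_deriv_def t_def sum_distrib_left)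
  also have "\<dots> = (\<Sum>p | p permutes ?J. \<Sum>i\<in>{v 0, v d}. t p i)"
    by (intro sum.cong refl sum.mono_neutral_right) (auto simp: other)
  \<comment> \<open>The endpoints coincide for \<open>d = 0\<close>, when the set
    \<open>{v 0, v d}\<close> contributes only one row.\<close>
  also have "\<dots> = (if v 0 = v d then 1 else 2) * t c (v 0)"
    by (simp add: sum.distrib T0 Td)
  finally have "t c (v 0) = 0" by (auto split: if_splits)
  moreover have "(\<Prod>j\<in>?J - {v 0}. L $ j $ c j) \<noteq> 0"
  proof -
    have "L $ v n $ c (v n) \<noteq> 0" if "n \<le> d" "v n \<noteq> v 0" for n
      using that c(3) edge L_sym by (cases n) auto
    then show ?thesis by (auto simp: prod_zero_iff)
  qed
  ultimately show ?thesis
    by (simp add: t_def c(2) sign_def split: if_splits)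
qed

text \<open>Strong induction on the length of a walk from \<open>i\<close> to \<open>j\<close>. If
  \<open>H $ i $ j\<close> is nonzero, the induction hypothesis rules out shorter walks between
  \<open>i\<close> and \<open>j\<close>, so the given walk is a shortest path. It also supplies the
  zeros of \<open>H\<close> at closer pairs on that path.\<close>

lemma entry_eq_0_of_minor_det_deriv:
  fixes L H :: "real^'n^'n"
  assumes L: "L \<in> sym_mats" and H: "H \<in> sym_mats"
    and deriv: "\<And>J. minor_det_deriv L J H = 0"
    and conn: "graph_connected L i j"
  shows "H $ i $ j = 0"
proof -
  define R where "R = {(a, b). L $ a $ b \<noteq> 0}"
  have "H $ i $ j = 0" if "(i, j) \<in> R ^^ d" for i j d
    using that
  proof (induction d arbitrary: i j rule: less_induct)
    case (less d)
    show ?case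
    proof (rule ccontr)
      assume nz: "H $ i $ j \<noteq> 0"
      obtain v where v: "v 0 = i" "v d = j" "\<And>m. m < d \<Longrightarrow> (v m, v (Suc m)) \<in> R"
        using less.prems by (auto simp: relpow_fun_conv)
      have path: "(v a, v b) \<in> R ^^ (b - a)" if "a \<le> b" "b \<le> d" for a b
        unfolding relpow_fun_conv using v(3) that by (intro exI[of _ "\<lambda>m. v (a + m)"]) auto
      \<comment> \<open>Replacing the segment from \<open>v a\<close> to \<open>v b\<close> by a
        walk of \<open>n\<close> steps cannot shorten the whole walk. The case \<open>n = 0\<close>
        gives injectivity, \<open>n = 1\<close> the absence of chords.\<close>
      have no_short: "d \<le> a + n + (d - b)" if "a \<le> d" "b \<le> d" "(v a, v b) \<in> R ^^ n" for a b n
      proof (rule ccontr)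
        assume "\<not> ?thesis"
        moreover have "(v 0, v d) \<in> R ^^ (a + n + (d - b))"
          using path[of 0 a] path[of b d] that unfolding relpow_add by auto
        ultimately show False using less.IH v nz by (metis not_le)
      qed
      have inj: "inj_on v {..d}"
      proof (rule linorder_inj_onI)
        fix a b assume "a < b" "a \<in> {..d}" "b \<in> {..d}"
        then show "v a \<noteq> v b" using no_short[of a b 0] by auto
      qed auto
      have "H $ v 0 $ v d = 0"
      proof (rule minor_det_deriv_shortest_path[OF L H inj _ _ _ deriv])
        show "L $ v m $ v (Suc m) \<noteq> 0" if "m < d" for m
          using v(3)[OF that] by (simp add: R_def)
        show "L $ v a $ v b = 0" if "b \<le> d" "Suc a < b" for a b
          using no_short[of a b 1] that by (cases "L $ v a $ v b = 0") (auto simp: R_def)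
        show "H $ v a $ v b = 0" if "a \<le> b" "b \<le> d" "b - a < d" for a b
          using less.IH[OF that(3) path] that by simp
      qed
      with nz v show False by simp
    qed
  qed
  then show ?thesis
    using conn by (auto simp: graph_connected_iff[OF L] R_def rtrancl_power)
qed

section \<open>Irreducibility and negative definiteness\<close>

text \<open>For an unconnected pair, the component of one point and its complement form a forbidden
  partition. Conversely, a path along nonzero entries can never leave a block of such a
  partition.\<close>

lemma irreducible_mat_iff_connected:
  fixes L :: "real^'n^'n"
  assumes L: "L \<in> sym_mats"
  shows "irreducible_mat L \<longleftrightarrow> (\<forall>i j. graph_connected L i j)"
proof
  assume irr: "irreducible_mat L"
  show "\<forall>i j. graph_connected L i j"
  proof (rule ccontr)
    assume "\<not> ?thesis"
    then obtain i j where ij: "\<not> graph_connected L i j" by blast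
    define C where "C = {k. graph_connected L i k}"
    have C: "i \<in> C" "j \<notin> C" using ij by (auto simp: C_def graph_connected_refl)
    have zero: "L $ a $ b = 0 \<and> L $ b $ a = 0" if "a \<in> C" "b \<notin> C" for a b
      using that graph_connected_trans graph_connected_edge graph_connected_sym
      unfolding C_def mem_Collect_eq by metis
    have "partition_on UNIV {C, - C}"
      using C by (auto simp: partition_on_def disjoint_def)
    moreover have "C \<noteq> - C" using C by blast
    then have "card {C, - C} \<ge> 2" by simp
    moreover have "\<forall>A\<in>{C, - C}. \<forall>B\<in>{C, - C}. A \<noteq> B \<longrightarrow> (\<forall>i\<in>A. \<forall>j\<in>B. L $ i $ j = 0)"
      using zero by auto
    ultimately show False using irr unfolding irreducible_mat_def by blast
  qed
next
  assume conn: "\<forall>i j. graph_connected L i j"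
  show "irreducible_mat L"
    unfolding irreducible_mat_def
  proof
    assume "\<exists>P. partition_on UNIV P \<and> card P \<ge> 2 \<and>
          (\<forall>A\<in>P. \<forall>B\<in>P. A \<noteq> B \<longrightarrow> (\<forall>i\<in>A. \<forall>j\<in>B. L $ i $ j = 0))"
    then obtain P where P: "partition_on UNIV P" "card P \<ge> 2"
      and zero: "\<forall>A\<in>P. \<forall>B\<in>P. A \<noteq> B \<longrightarrow> (\<forall>i\<in>A. \<forall>j\<in>B. L $ i $ j = 0)"
      by (elim exE conjE)
    obtain A B where AB: "A \<in> P" "B \<in> P" "A \<noteq> B"
      using P(2) card_le_Suc0_iff_eq[of P] by auto
    then obtain i j where i: "i \<in> A" and j: "j \<in> B"
      using P(1) unfolding partition_on_def by (metis ex_in_conv)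
    have "(i, j) \<in> {(a, b). L $ a $ b \<noteq> 0}\<^sup>*"
      using conn by (simp add: graph_connected_iff[OF L])
    then have "j \<in> A"
    proof induction
      case (step y z)
      obtain C where "C \<in> P" "z \<in> C" using P(1) unfolding partition_on_def by blast
      then show ?case using zero AB(1) step.IH step.hyps by (cases "A = C") auto
    qed (rule i)
    then show False
      using j AB P(1) unfolding partition_on_def disjoint_def by blast
  qed
qed

theorem theorem3:
  fixes Ls :: "real^'n^'n"
  assumes "Ls \<in> spd_mats"
  shows "{H \<in> sym_mats. hessian_loglik Ls Ls H H = 0}
           = {H \<in> sym_mats. \<forall>i j. graph_connected Ls i j \<longrightarrow> H $ i $ j = 0}
       \<and> (negative_definite_on sym_mats (hessian_loglik Ls Ls) \<longleftrightarrow> irreducible_mat Ls)"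
proof -
  have sym: "Ls \<in> sym_mats" using assms by (simp add: spd_mats_def)
  have null: "hessian_loglik Ls Ls H H = 0 \<longleftrightarrow> (\<forall>i j. graph_connected Ls i j \<longrightarrow> H $ i $ j = 0)"
    if "H \<in> sym_mats" for H
    using hessian_loglik_nonpos(2)[OF assms that] minor_det_deriv_eq_0[of Ls H]
      entry_eq_0_of_minor_det_deriv[OF sym that] by blast
  \<comment> \<open>Since the form is nonpositive on symmetric matrices, negative definiteness
    amounts to a trivial null space.\<close>
  have "negative_definite_on sym_mats (hessian_loglik Ls Ls) \<longleftrightarrow>
      (\<forall>H\<in>sym_mats. (\<forall>i j. graph_connected Ls i j \<longrightarrow> H $ i $ j = 0) \<longrightarrow> H = 0)"
    unfolding negative_definite_on_def
    using hessian_loglik_nonpos(1)[OF assms] null by (metis less_irrefl order_less_le)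
  also have "\<dots> \<longleftrightarrow> (\<forall>i j. graph_connected Ls i j)"
  proof
    assume triv: "\<forall>H\<in>sym_mats. (\<forall>i j. graph_connected Ls i j \<longrightarrow> H $ i $ j = 0) \<longrightarrow> H = 0"
    show "\<forall>i j. graph_connected Ls i j"
    proof (rule ccontr)
      assume "\<not> ?thesis"
      then obtain a b where ab: "\<not> graph_connected Ls a b" by blast
      \<comment> \<open>A nonzero symmetric matrix supported on the unconnected pair lies in the
        null space.\<close>
      define H :: "real^'n^'n" where "H = (\<chi> i j. if {i, j} = {a, b} then 1 else 0)"
      have "H \<in> sym_mats"
        by (simp add: H_def sym_mats_def transpose_def insert_commute)
      moreover have "H $ i $ j = 0" if "graph_connected Ls i j" for i j
        using that ab graph_connected_sym by (auto simp: H_def doubleton_eq_iff)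
      ultimately have "H = 0" using triv by blast
      then have "H $ a $ b = 0" by simp
      then show False by (simp add: H_def)
    qed
  qed (simp add: vec_eq_iff)
  finally have "negative_definite_on sym_mats (hessian_loglik Ls Ls) \<longleftrightarrow> irreducible_mat Ls"
    unfolding irreducible_mat_iff_connected[OF sym] .
  then show ?thesis
    using null by (intro conjI Collect_cong conj_cong refl)
qed

end
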